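(* Let $\mathcal D_s\subseteq\mathcal D$ have index set $\mathcal S$, let $\bm\theta_t\in\Theta$ be an iterate, let $\pi_{ij}^t:=\pi_{ij}(\bm\theta_t)$ and $\bar{\bm a}_i^t:=\sum_{j\in\{0\}\cup\mathcal J}\pi_{ij}^t\bm a_{ij}$, and let $(\bm d_t,\bm\mu_t)$ be a primal–dual (KKT) solution of the constrained Newton subproblem $$\min_{\bm d}\Big\{\bm g_t^\top\bm d+\tfrac12\bm d^\top\bm G_t\bm d\;:\;\bm A_\Theta(\bm\theta_t+\bm d)\le\bm b_\Theta\Big\},$$ where $\bm g_t=\nabla\mathcal L_{\mathcal S}(\bm\theta_t)$ and $\bm G_t=\nabla^2\mathcal L_{\mathcal S}(\bm\theta_t)$. Define, for $i\in\mathcal S$ and $j\in\{0\}\cup\mathcal J$, $$q_{ij}^t:=\pi_{ij}^t\left[1+(\bm a_{ij}-\bar{\bm a}_i^t)^\top\bm d_t\right].$$ If $q_{ij}^t\ge0$ for all $i\in\mathcal S$ and $j\in\{0\}\cup\mathcal J$, then $$\mathrm{LB}_t(\mathcal D_s):=\lambda N_0+\mathcal H_{\mathcal S}(\bm q^t)-\bm b_\Theta^\top\bm\mu_t\;\le\;H(\mathcal D_s).$$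
   Context: $\mathcal J$ is a finite nonempty set of products, $0$ is the outside option, $\mathcal F$ is a finite set of covariates. Data: $\mathcal D=\{(\bm x_i,\bm p_i,y_i)\}_{i\in\mathcal I}$, $\mathcal I$ finite, $\bm x_i\in\mathbb R^{|\mathcal F|}$, $\bm p_i\in\mathbb R_+^{|\mathcal J|}$, $y_i\in\{0\}\cup\mathcal J$. Parameters $\bm\theta=(\bm\alpha,\bm\beta,\bm\gamma)\in\mathbb R^{N_0}$, $N_0=2|\mathcal J|+|\mathcal F|$. With $\bm e_j$ the $j$th coordinate vector of $\mathbb R^{|\mathcal J|}$, set $\bm a_{ij}=(\bm e_j,\bm x_i,-p_{ij}\bm e_j)\in\mathbb R^{N_0}$ for $j\in\mathcal J$ and $\bm a_{i0}=\bm0$. Multinomial logit probabilities: $\pi_{ij}(\bm\theta)=\exp(\bm a_{ij}^\top\bm\theta)/\sum_{l\in\{0\}\cup\mathcal J}\exp(\bm a_{il}^\top\bm\theta)$; $\ell_i(\bm\theta)=-\log\pi_{i,y_i}(\bm\theta)$; $\mathcal L_{\mathcal S}(\bm\theta)=\sum_{i\in\mathcal S}\ell_i(\bm\theta)$. $\Theta=\{\bm\theta\in\mathbb R^{N_0}:\bm A_\Theta\bm\theta\le\bm b_\Theta\}$ is a nonempty closed polyhedron (whose constraints include $\gamma_j\ge\underline\gamma>0$ for all $j$). Given a penalty $\lambda\ge0$ and minimum leaf size $N_{\min}\ge1$, the leaf cost is $H(\mathcal D_s)=\min_{\bm\theta\in\Theta}\{\mathcal L_{\mathcal S}(\bm\theta)+\lambda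 N_0\}$ if $|\mathcal D_s|\ge N_{\min}$ and $+\infty$ otherwise; every finite leaf problem is assumed to attain its minimum. Entropy: $\mathcal H_{\mathcal S}(\bm q)=-\sum_{i\in\mathcal S}\sum_{j\in\{0\}\cup\mathcal J}q_{ij}\log q_{ij}$ with $0\log0=0$. A primal–dual (KKT) solution $(\bm d_t,\bm\mu_t)$ of the subproblem satisfies $\bm A_\Theta(\bm\theta_t+\bm d_t)\le\bm b_\Theta$, $\bm\mu_t\ge\bm0$, $\bm g_t+\bm G_t\bm d_t+\bm A_\Theta^\top\bm\mu_t=\bm0$, and $\bm\mu_t^\top(\bm b_\Theta-\bm A_\Theta(\bm\theta_t+\bm d_t))=0$. *)

theory Defs
  imports "HOL-Analysis.Analysis"
begin

text \<open>
  The covariate set may be empty, so index sets are explicit finite sets rather than types: a vector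
  of \<open>\<real>\<^sup>K\<close> is a function of which only the values on \<open>K\<close> are ever used. The coordinates of
  \<open>\<theta> = (\<alpha>, \<beta>, \<gamma>)\<close> are indexed by \<open>params J F\<close>, and the options \<open>{0} \<union> J\<close> by \<open>choices J\<close>,
  with \<open>None\<close> for the outside option.
\<close>

datatype ('j, 'f) param = Alpha_at 'j | Beta_at 'f | Gamma_at 'j

definition params :: "'j set \<Rightarrow> 'f set \<Rightarrow> ('j, 'f) param set" where
  "params J F = Alpha_at ` J \<union> Beta_at ` F \<union> Gamma_at ` J"

definition num_params :: "'j set \<Rightarrow> 'f set \<Rightarrow> nat" where
  "num_params J F = 2 * card J + card F"

definition choices :: "'j set \<Rightarrow> 'j option set" where
  "choices J = insert None (Some ` J)"

definition dot :: "'k set \<Rightarrow> ('k \<Rightarrow> real) \<Rightarrow> ('k \<Rightarrow> real) \<Rightarrow> real" where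
  "dot K u v = (\<Sum>k\<in>K. u k * v k)"

fun attr :: "('i \<Rightarrow> 'f \<Rightarrow> real) \<Rightarrow> ('i \<Rightarrow> 'j \<Rightarrow> real) \<Rightarrow> 'i \<Rightarrow> 'j option \<Rightarrow> ('j, 'f) param \<Rightarrow> real"
where
  "attr x p i None _ = 0"
| "attr x p i (Some j) (Alpha_at k) = (if k = j then 1 else 0)"
| "attr x p i (Some j) (Beta_at f) = x i f"
| "attr x p i (Some j) (Gamma_at k) = (if k = j then - p i j else 0)"

definition mnl_prob ::
  "'j set \<Rightarrow> 'f set \<Rightarrow> ('i \<Rightarrow> 'f \<Rightarrow> real) \<Rightarrow> ('i \<Rightarrow> 'j \<Rightarrow> real)
    \<Rightarrow> (('j, 'f) param \<Rightarrow> real) \<Rightarrow> 'i \<Rightarrow> 'j option \<Rightarrow> real" where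
  "mnl_prob J F x p \<theta> i j =
     exp (dot (params J F) (attr x p i j) \<theta>)
       / (\<Sum>l\<in>choices J. exp (dot (params J F) (attr x p i l) \<theta>))"

definition mnl_loss ::
  "'j set \<Rightarrow> 'f set \<Rightarrow> ('i \<Rightarrow> 'f \<Rightarrow> real) \<Rightarrow> ('i \<Rightarrow> 'j \<Rightarrow> real) \<Rightarrow> ('i \<Rightarrow> 'j option)
    \<Rightarrow> 'i set \<Rightarrow> (('j, 'f) param \<Rightarrow> real) \<Rightarrow> real" where
  "mnl_loss J F x p y S \<theta> = (\<Sum>i\<in>S. - ln (mnl_prob J F x p \<theta> i (y i)))"

definition mean_attr ::
  "'j set \<Rightarrow> 'f set \<Rightarrow> ('i \<Rightarrow> 'f \<Rightarrow> real) \<Rightarrow> ('i \<Rightarrow> 'j \<Rightarrow> real)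
    \<Rightarrow> (('j, 'f) param \<Rightarrow> real) \<Rightarrow> 'i \<Rightarrow> ('j, 'f) param \<Rightarrow> real" where
  "mean_attr J F x p \<theta> i = (\<lambda>k. \<Sum>j\<in>choices J. mnl_prob J F x p \<theta> i j * attr x p i j k)"

definition grad :: "(('k \<Rightarrow> real) \<Rightarrow> real) \<Rightarrow> ('k \<Rightarrow> real) \<Rightarrow> 'k \<Rightarrow> real" where
  "grad f \<theta> k = deriv (\<lambda>t. f (\<theta>(k := t))) (\<theta> k)"

definition hessian :: "(('k \<Rightarrow> real) \<Rightarrow> real) \<Rightarrow> ('k \<Rightarrow> real) \<Rightarrow> 'k \<Rightarrow> 'k \<Rightarrow> real" where
  "hessian f \<theta> k l = grad (\<lambda>\<eta>. grad f \<eta> l) \<theta> k"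

definition polyhedron_of ::
  "'k set \<Rightarrow> 'r set \<Rightarrow> ('r \<Rightarrow> 'k \<Rightarrow> real) \<Rightarrow> ('r \<Rightarrow> real) \<Rightarrow> ('k \<Rightarrow> real) set" where
  "polyhedron_of K R A b = {\<theta>. \<forall>r\<in>R. dot K (A r) \<theta> \<le> b r}"

definition newton_kkt ::
  "'k set \<Rightarrow> 'r set \<Rightarrow> ('r \<Rightarrow> 'k \<Rightarrow> real) \<Rightarrow> ('r \<Rightarrow> real) \<Rightarrow> (('k \<Rightarrow> real) \<Rightarrow> real)
    \<Rightarrow> ('k \<Rightarrow> real) \<Rightarrow> ('k \<Rightarrow> real) \<Rightarrow> ('r \<Rightarrow> real) \<Rightarrow> bool" where
  "newton_kkt K R A b L \<theta> d \<mu> \<longleftrightarrow>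
     (\<lambda>k. \<theta> k + d k) \<in> polyhedron_of K R A b \<and>
     (\<forall>r\<in>R. 0 \<le> \<mu> r) \<and>
     (\<forall>k\<in>K. grad L \<theta> k + (\<Sum>l\<in>K. hessian L \<theta> k l * d l) + (\<Sum>r\<in>R. A r k * \<mu> r) = 0) \<and>
     (\<Sum>r\<in>R. \<mu> r * (b r - dot K (A r) (\<lambda>k. \<theta> k + d k))) = 0"

definition newton_q ::
  "'j set \<Rightarrow> 'f set \<Rightarrow> ('i \<Rightarrow> 'f \<Rightarrow> real) \<Rightarrow> ('i \<Rightarrow> 'j \<Rightarrow> real)
    \<Rightarrow> (('j, 'f) param \<Rightarrow> real) \<Rightarrow> (('j, 'f) param \<Rightarrow> real) \<Rightarrow> 'i \<Rightarrow> 'j option \<Rightarrow> real" where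
  "newton_q J F x p \<theta> d i j =
     mnl_prob J F x p \<theta> i j *
       (1 + dot (params J F) (\<lambda>k. attr x p i j k - mean_attr J F x p \<theta> i k) d)"

text \<open>The convention \<open>0 log 0 = 0\<close> is automatic, as the factor \<open>0\<close> annihilates \<open>ln 0\<close>.\<close>

definition entropy_sum :: "'j set \<Rightarrow> 'i set \<Rightarrow> ('i \<Rightarrow> 'j option \<Rightarrow> real) \<Rightarrow> real" where
  "entropy_sum J S q = - (\<Sum>i\<in>S. \<Sum>j\<in>choices J. q i j * ln (q i j))"

definition leaf_objective ::
  "'j set \<Rightarrow> 'f set \<Rightarrow> ('i \<Rightarrow> 'f \<Rightarrow> real) \<Rightarrow> ('i \<Rightarrow> 'j \<Rightarrow> real) \<Rightarrow> ('i \<Rightarrow> 'j option)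
    \<Rightarrow> real \<Rightarrow> 'i set \<Rightarrow> (('j, 'f) param \<Rightarrow> real) \<Rightarrow> real" where
  "leaf_objective J F x p y lam S \<theta> = mnl_loss J F x p y S \<theta> + lam * real (num_params J F)"

definition attains_min :: "('a \<Rightarrow> real) \<Rightarrow> 'a set \<Rightarrow> bool" where
  "attains_min f X \<longleftrightarrow> (\<exists>z\<in>X. \<forall>w\<in>X. f z \<le> f w)"

text \<open>
  The size of a leaf is the cardinality of its index set, so repeated observations count separately.
  The \<open>LEAST\<close> term is the minimum over \<open>\<Theta>\<close>; it is meaningful only where \<open>attains_min\<close> holds.
\<close>

definition leaf_cost ::
  "'j set \<Rightarrow> 'f set \<Rightarrow> ('i \<Rightarrow> 'f \<Rightarrow> real) \<Rightarrow> ('i \<Rightarrow> 'j \<Rightarrow> real) \<Rightarrow> ('i \<Rightarrow> 'j option)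
    \<Rightarrow> (('j, 'f) param \<Rightarrow> real) set \<Rightarrow> real \<Rightarrow> nat \<Rightarrow> 'i set \<Rightarrow> ereal" where
  "leaf_cost J F x p y \<Theta> lam Nmin S =
     (if Nmin \<le> card S
      then ereal (LEAST v. v \<in> leaf_objective J F x p y lam S ` \<Theta>)
      else \<infinity>)"

definition newton_LB ::
  "'j set \<Rightarrow> 'f set \<Rightarrow> ('i \<Rightarrow> 'f \<Rightarrow> real) \<Rightarrow> ('i \<Rightarrow> 'j \<Rightarrow> real) \<Rightarrow> 'r set \<Rightarrow> ('r \<Rightarrow> real)
    \<Rightarrow> real \<Rightarrow> 'i set \<Rightarrow> (('j, 'f) param \<Rightarrow> real) \<Rightarrow> (('j, 'f) param \<Rightarrow> real) \<Rightarrow> ('r \<Rightarrow> real)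
    \<Rightarrow> real" where
  "newton_LB J F x p R b lam S \<theta> d \<mu> =
     lam * real (num_params J F) + entropy_sum J S (newton_q J F x p \<theta> d) - dot R b \<mu>"

end

theory Submission
  imports Defs
begin

text \<open>
  Write \<open>Z\<^sub>i(\<eta>) = \<Sum>\<^sub>j exp (a\<^sub>i\<^sub>j \<bullet> \<eta>)\<close>, so that the loss of observation \<open>i\<close> is \<open>ln Z\<^sub>i(\<eta>)\<close> minus the
  linear term \<open>a\<^sub>i\<^sub>y \<bullet> \<eta>\<close> of the observed choice \<open>y\<close>. The bound is weak Lagrangian duality, with the
  log-sum-exp function bounded below by its conjugate, the negative entropy. For any nonnegative
  weights \<open>q\<^sub>i\<close> of total mass one, Gibbs' inequality (\<open>entropy_plus_mean_le_ln_sum_exp\<close>) gives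
  \<open>ln Z\<^sub>i(\<eta>) \<ge> \<Sum>\<^sub>j q\<^sub>i\<^sub>j (a\<^sub>i\<^sub>j \<bullet> \<eta>) - \<Sum>\<^sub>j q\<^sub>i\<^sub>j ln q\<^sub>i\<^sub>j\<close>, and summing over the observations yields
  \<open>L(\<eta>) \<ge> H(q) + r \<bullet> \<eta>\<close> with the residual vector \<open>r = \<Sum>\<^sub>i (\<Sum>\<^sub>j q\<^sub>i\<^sub>j a\<^sub>i\<^sub>j - a\<^sub>i\<^sub>y)\<close>
  (\<open>mnl_loss_ge_entropy_plus_residual\<close>). If \<open>r = - A\<^sup>T \<mu>\<close> with \<open>\<mu> \<ge> 0\<close>, then every feasible
  \<open>\<eta>\<close> satisfies \<open>r \<bullet> \<eta> = - \<mu> \<bullet> A \<eta> \<ge> - b \<bullet> \<mu>\<close>, which is the claimed bound.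

  The weights produced by the Newton step do satisfy \<open>r = - A\<^sup>T \<mu>\<close>. They are the first-order change
  of the choice probabilities \<open>\<pi>\<close> in direction \<open>d\<close>. The gradient of \<open>L\<close> is the residual of \<open>\<pi>\<close>
  itself and its Hessian is the sum of the covariance matrices of the attributes under \<open>\<pi>\<close>, so the
  residual of the Newton weights is exactly \<open>g + G d\<close> (\<open>newton_residual\<close>), and stationarity of the
  subproblem identifies it with \<open>- A\<^sup>T \<mu>\<close>. The total mass stays one because the first-order
  change has mean zero; nonnegativity is the hypothesis of the theorem.
\<close>

section \<open>Gibbs' inequality\<close>

text \<open>
  The left-hand side falls short of \<open>ln Z\<close> by the relative entropy of \<open>q\<close> with respect to the
  softmax weights \<open>exp (u j) / Z\<close>. Its nonnegativity follows from \<open>ln t \<le> t - 1\<close> at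
  \<open>t = exp (u j) / (Z q\<^sub>j)\<close>, multiplied by \<open>q\<^sub>j\<close> and summed over the \<open>j\<close> with \<open>q\<^sub>j > 0\<close>; the other
  \<open>j\<close> contribute zero on the left.
\<close>

lemma entropy_plus_mean_le_ln_sum_exp:
  fixes q u :: "'a \<Rightarrow> real"
  assumes fin: "finite C" and nonneg: "\<And>j. j \<in> C \<Longrightarrow> 0 \<le> q j" and mass: "(\<Sum>j\<in>C. q j) = 1"
  shows "(\<Sum>j\<in>C. q j * u j) - (\<Sum>j\<in>C. q j * ln (q j)) \<le> ln (\<Sum>j\<in>C. exp (u j))"
proof -
  define Z where "Z = (\<Sum>j\<in>C. exp (u j))"
  have "C \<noteq> {}" using mass by auto
  then have Z: "Z > 0" unfolding Z_def using fin by (intro sum_pos) auto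
  have pointwise: "q j * u j - q j * ln (q j) - q j * ln Z \<le> exp (u j) / Z - q j" if "j \<in> C" for j
  proof (cases "q j = 0")
    case True
    then show ?thesis using Z by simp
  next
    case False
    then have q: "q j > 0" using nonneg[OF that] by simp
    have "ln (exp (u j) / (Z * q j)) \<le> exp (u j) / (Z * q j) - 1"
      using Z q by (intro ln_le_minus_one) simp
    moreover have "ln (exp (u j) / (Z * q j)) = u j - (ln Z + ln (q j))"
      using Z q by (simp add: ln_div ln_mult)
    ultimately have "q j * (u j - (ln Z + ln (q j))) \<le> q j * (exp (u j) / (Z * q j) - 1)"
      using q by simp
    also have "\<dots> = exp (u j) / Z - q j" using Z q by (simp add: field_simps)
    finally show ?thesis by (simp add: algebra_simps)
  qed
  have "(\<Sum>j\<in>C. q j * u j - q j * ln (q j) - q j * ln Z) \<le> (\<Sum>j\<in>C. exp (u j) / Z - q j)"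
    by (intro sum_mono pointwise)
  also have "\<dots> = 0"
    using Z mass by (simp add: sum_subtractf Z_def flip: sum_divide_distrib)
  finally show ?thesis
    using mass by (simp add: sum_subtractf Z_def flip: sum_distrib_right)
qed

section \<open>Choice probabilities and their derivatives\<close>

lemma finite_params: "finite J \<Longrightarrow> finite F \<Longrightarrow> finite (params J F)"
  by (simp add: params_def)

lemma finite_choices: "finite J \<Longrightarrow> finite (choices J)"
  by (simp add: choices_def)

lemma sum_exp_choices_pos: "finite J \<Longrightarrow> 0 < (\<Sum>l\<in>choices J. exp (f l :: real))"
  by (rule sum_pos) (auto simp: choices_def)

lemma mnl_prob_pos: "finite J \<Longrightarrow> 0 < mnl_prob J F x p \<theta> i j"
  unfolding mnl_prob_def by (simp add: sum_exp_choices_pos)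

lemma sum_mnl_prob:
  assumes "finite J"
  shows "(\<Sum>j\<in>choices J. mnl_prob J F x p \<theta> i j) = 1"
  using sum_exp_choices_pos[OF assms, of "\<lambda>l. dot (params J F) (attr x p i l) \<theta>"]
  by (simp add: mnl_prob_def flip: sum_divide_distrib)

lemma ln_mnl_prob:
  assumes "finite J"
  shows "ln (mnl_prob J F x p \<theta> i j) = dot (params J F) (attr x p i j) \<theta>
           - ln (\<Sum>l\<in>choices J. exp (dot (params J F) (attr x p i l) \<theta>))"
  using sum_exp_choices_pos[OF assms, of "\<lambda>l. dot (params J F) (attr x p i l) \<theta>"]
  by (simp add: mnl_prob_def ln_div)

lemma dot_update_has_derivative:
  assumes "finite K" "k \<in> K"
  shows "((\<lambda>t. dot K u (\<theta>(k := t))) has_real_derivative u k) (at s)"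
proof -
  have "dot K u (\<theta>(k := t)) = u k * t + (\<Sum>l\<in>K - {k}. u l * \<theta> l)" for t
    unfolding dot_def by (subst sum.remove[OF assms]) (auto intro: sum.cong)
  then show ?thesis by (auto intro!: derivative_eq_intros)
qed

text \<open>
  The logarithmic derivative of a softmax weight is the score of an exponential family: the
  sufficient statistic, here the attribute, centred at its mean.
\<close>

lemma mnl_prob_has_derivative:
  assumes "finite J" "finite F" "k \<in> params J F"
  shows "((\<lambda>t. mnl_prob J F x p (\<theta>(k := t)) i j) has_real_derivative
           mnl_prob J F x p \<theta> i j * (attr x p i j k - mean_attr J F x p \<theta> i k)) (at (\<theta> k))"
proof -
  define u where "u = (\<lambda>l. dot (params J F) (attr x p i l))"
  define Z where "Z = (\<Sum>l\<in>choices J. exp (u l \<theta>))"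
  have Z: "Z > 0" unfolding Z_def using assms(1) by (rule sum_exp_choices_pos)
  have du: "((\<lambda>t. u l (\<theta>(k := t))) has_real_derivative attr x p i l k) (at (\<theta> k))" for l
    unfolding u_def using assms by (intro dot_update_has_derivative finite_params)
  have de: "((\<lambda>t. exp (u l (\<theta>(k := t)))) has_real_derivative exp (u l \<theta>) * attr x p i l k)
              (at (\<theta> k))" for l
    by (rule derivative_eq_intros du refl)+ simp
  have mean: "mean_attr J F x p \<theta> i k = (\<Sum>l\<in>choices J. exp (u l \<theta>) * attr x p i l k) / Z"
    by (simp add: mean_attr_def mnl_prob_def u_def Z_def sum_divide_distrib)
  have "((\<lambda>t. exp (u j (\<theta>(k := t))) / (\<Sum>l\<in>choices J. exp (u l (\<theta>(k := t))))) has_real_derivative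
          (exp (u j \<theta>) * attr x p i j k * Z
            - exp (u j \<theta>) * (\<Sum>l\<in>choices J. exp (u l \<theta>) * attr x p i l k)) / (Z * Z)) (at (\<theta> k))"
    using DERIV_divide[OF de[of j] DERIV_sum[of "choices J", OF de]] Z by (simp add: Z_def)
  moreover have "(exp (u j \<theta>) * attr x p i j k * Z
            - exp (u j \<theta>) * (\<Sum>l\<in>choices J. exp (u l \<theta>) * attr x p i l k)) / (Z * Z)
          = exp (u j \<theta>) / Z * (attr x p i j k - mean_attr J F x p \<theta> i k)"
    using Z by (simp add: mean field_simps)
  ultimately show ?thesis
    by (simp add: mnl_prob_def u_def Z_def)
qed

lemma grad_mnl_loss:
  assumes "finite J" "finite F" "k \<in> params J F"
  shows "grad (mnl_loss J F x p y S) \<theta> k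
           = (\<Sum>i\<in>S. mean_attr J F x p \<theta> i k - attr x p i (y i) k)"
proof -
  have "((\<lambda>t. - ln (mnl_prob J F x p (\<theta>(k := t)) i (y i))) has_real_derivative
          mean_attr J F x p \<theta> i k - attr x p i (y i) k) (at (\<theta> k))" for i
    using mnl_prob_pos[OF assms(1), of F x p \<theta> i "y i"]
    by (auto intro!: derivative_eq_intros mnl_prob_has_derivative[OF assms])
  then have "((\<lambda>t. mnl_loss J F x p y S (\<theta>(k := t))) has_real_derivative
          (\<Sum>i\<in>S. mean_attr J F x p \<theta> i k - attr x p i (y i) k)) (at (\<theta> k))"
    unfolding mnl_loss_def by (intro DERIV_sum)
  then show ?thesis unfolding grad_def by (rule DERIV_imp_deriv)
qed

text \<open>
  Each observation contributes the covariance of attributes \<open>k\<close> and \<open>l\<close> under the choice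
  probabilities. Centring one factor suffices for a covariance; centring \<open>l\<close> rather than \<open>k\<close> gives
  the form in which the Newton weights appear.
\<close>

lemma hessian_mnl_loss:
  assumes "finite J" "finite F" "k \<in> params J F" "l \<in> params J F"
  shows "hessian (mnl_loss J F x p y S) \<theta> k l
           = (\<Sum>i\<in>S. \<Sum>j\<in>choices J. mnl_prob J F x p \<theta> i j * attr x p i j k
                  * (attr x p i j l - mean_attr J F x p \<theta> i l))"
proof -
  let ?P = "mnl_prob J F x p \<theta>" and ?m = "mean_attr J F x p \<theta>"
  have "((\<lambda>t. mean_attr J F x p (\<theta>(k := t)) i l - attr x p i (y i) l) has_real_derivative
          (\<Sum>j\<in>choices J. ?P i j * (attr x p i j k - ?m i k) * attr x p i j l)) (at (\<theta> k))" for i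
    unfolding mean_attr_def
    by (auto intro!: derivative_eq_intros mnl_prob_has_derivative[OF assms(1-3), unfolded mean_attr_def]
             simp: mult_ac)
  then have "((\<lambda>t. \<Sum>i\<in>S. mean_attr J F x p (\<theta>(k := t)) i l - attr x p i (y i) l)
      has_real_derivative
          (\<Sum>i\<in>S. \<Sum>j\<in>choices J. ?P i j * (attr x p i j k - ?m i k) * attr x p i j l)) (at (\<theta> k))"
    by (intro DERIV_sum)
  then have "hessian (mnl_loss J F x p y S) \<theta> k l
      = (\<Sum>i\<in>S. \<Sum>j\<in>choices J. ?P i j * (attr x p i j k - ?m i k) * attr x p i j l)"
    unfolding hessian_def grad_mnl_loss[OF assms(1,2,4)] grad_def[of _ \<theta> k]
    by (rule DERIV_imp_deriv)
  also have "\<dots> = (\<Sum>i\<in>S. \<Sum>j\<in>choices J. ?P i j * attr x p i j k * (attr x p i j l - ?m i l))"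
  proof (rule sum.cong[OF refl])
    fix i
    have "(\<Sum>j\<in>choices J. ?P i j * (attr x p i j k - ?m i k) * attr x p i j l)
        = (\<Sum>j\<in>choices J. ?P i j * attr x p i j k * attr x p i j l) - ?m i k * ?m i l"
      unfolding mean_attr_def[of J F x p \<theta> i, THEN fun_cong, of l]
      by (simp add: algebra_simps sum_subtractf sum_distrib_left)
    moreover have "(\<Sum>j\<in>choices J. ?P i j * attr x p i j k * (attr x p i j l - ?m i l))
        = (\<Sum>j\<in>choices J. ?P i j * attr x p i j k * attr x p i j l) - ?m i k * ?m i l"
      unfolding mean_attr_def[of J F x p \<theta> i, THEN fun_cong, of k]
      by (simp add: algebra_simps sum_subtractf sum_distrib_left)
    ultimately show "(\<Sum>j\<in>choices J. ?P i j * (attr x p i j k - ?m i k) * attr x p i j l)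
        = (\<Sum>j\<in>choices J. ?P i j * attr x p i j k * (attr x p i j l - ?m i l))" by simp
  qed
  finally show ?thesis .
qed

section \<open>The Newton weights\<close>

text \<open>The first-order change has mass zero because attributes centred at their mean average to zero.\<close>

lemma sum_newton_q:
  assumes "finite J"
  shows "(\<Sum>j\<in>choices J. newton_q J F x p \<theta> d i j) = 1"
proof -
  let ?P = "mnl_prob J F x p \<theta> i" and ?m = "mean_attr J F x p \<theta> i"
  have centred: "(\<Sum>j\<in>choices J. ?P j * (attr x p i j l - ?m l)) = 0" for l
  proof -
    have "(\<Sum>j\<in>choices J. ?P j * (attr x p i j l - ?m l)) = ?m l - (\<Sum>j\<in>choices J. ?P j) * ?m l"
      by (simp add: right_diff_distrib sum_subtractf sum_distrib_right mean_attr_def)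
    then show ?thesis by (simp add: sum_mnl_prob[OF assms])
  qed
  have "(\<Sum>j\<in>choices J. ?P j * dot (params J F) (\<lambda>k. attr x p i j k - ?m k) d)
      = (\<Sum>j\<in>choices J. \<Sum>l\<in>params J F. ?P j * (attr x p i j l - ?m l) * d l)"
    by (simp add: dot_def sum_distrib_left mult.assoc)
  also have "\<dots> = (\<Sum>l\<in>params J F. (\<Sum>j\<in>choices J. ?P j * (attr x p i j l - ?m l)) * d l)"
    by (subst sum.swap) (simp add: sum_distrib_right)
  also have "\<dots> = 0" by (simp add: centred)
  finally show ?thesis
    by (simp add: newton_q_def distrib_left sum.distrib sum_mnl_prob[OF assms])
qed

text \<open>
  The model gradient \<open>g + G d\<close> of the Newton subproblem is an attribute residual: the same expression
  as the gradient, with the choice probabilities replaced by the Newton weights.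
\<close>

lemma newton_residual:
  assumes "finite J" "finite F" "k \<in> params J F"
  shows "grad (mnl_loss J F x p y S) \<theta> k
           + (\<Sum>l\<in>params J F. hessian (mnl_loss J F x p y S) \<theta> k l * d l)
         = (\<Sum>i\<in>S. (\<Sum>j\<in>choices J. newton_q J F x p \<theta> d i j * attr x p i j k)
                  - attr x p i (y i) k)"
proof -
  let ?P = "mnl_prob J F x p \<theta>" and ?m = "mean_attr J F x p \<theta>" and ?K = "params J F"
  have "(\<Sum>l\<in>?K. hessian (mnl_loss J F x p y S) \<theta> k l * d l)
      = (\<Sum>l\<in>?K. \<Sum>i\<in>S. \<Sum>j\<in>choices J. ?P i j * attr x p i j k * (attr x p i j l - ?m i l) * d l)"
    using assms by (intro sum.cong refl) (simp add: hessian_mnl_loss sum_distrib_right)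
  also have "\<dots> = (\<Sum>i\<in>S. \<Sum>l\<in>?K. \<Sum>j\<in>choices J.
                     ?P i j * attr x p i j k * (attr x p i j l - ?m i l) * d l)"
    by (rule sum.swap)
  also have "\<dots> = (\<Sum>i\<in>S. \<Sum>j\<in>choices J. \<Sum>l\<in>?K.
                     ?P i j * attr x p i j k * (attr x p i j l - ?m i l) * d l)"
    by (intro sum.cong refl sum.swap)
  also have "\<dots> = (\<Sum>i\<in>S. \<Sum>j\<in>choices J.
                     ?P i j * attr x p i j k * dot ?K (\<lambda>l. attr x p i j l - ?m i l) d)"
    by (simp add: dot_def sum_distrib_left mult.assoc)
  finally have hess: "(\<Sum>l\<in>?K. hessian (mnl_loss J F x p y S) \<theta> k l * d l)
      = (\<Sum>i\<in>S. \<Sum>j\<in>choices J.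
            ?P i j * attr x p i j k * dot ?K (\<lambda>l. attr x p i j l - ?m i l) d)" .
  have weights: "(\<Sum>j\<in>choices J. newton_q J F x p \<theta> d i j * attr x p i j k)
      = ?m i k
        + (\<Sum>j\<in>choices J. ?P i j * attr x p i j k * dot ?K (\<lambda>l. attr x p i j l - ?m i l) d)" for i
    unfolding mean_attr_def[of J F x p \<theta> i, THEN fun_cong, of k] newton_q_def
    by (simp add: sum.distrib[symmetric] algebra_simps)
  show ?thesis
    by (simp add: grad_mnl_loss[OF assms] hess weights sum.distrib sum_subtractf)
qed

section \<open>The lower bound\<close>

lemma mnl_loss_ge_entropy_plus_residual:
  assumes fin: "finite J"
    and nonneg: "\<And>i j. i \<in> S \<Longrightarrow> j \<in> choices J \<Longrightarrow> 0 \<le> q i j"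
    and mass: "\<And>i. i \<in> S \<Longrightarrow> (\<Sum>j\<in>choices J. q i j) = 1"
  shows "entropy_sum J S q
           + dot (params J F)
               (\<lambda>k. \<Sum>i\<in>S. (\<Sum>j\<in>choices J. q i j * attr x p i j k) - attr x p i (y i) k) \<eta>
         \<le> mnl_loss J F x p y S \<eta>"
proof -
  let ?K = "params J F"
  let ?u = "\<lambda>i j. dot ?K (attr x p i j) \<eta>"
  have "dot ?K (\<lambda>k. \<Sum>i\<in>S. (\<Sum>j\<in>choices J. q i j * attr x p i j k) - attr x p i (y i) k) \<eta>
      = (\<Sum>i\<in>S. \<Sum>k\<in>?K. ((\<Sum>j\<in>choices J. q i j * attr x p i j k) - attr x p i (y i) k) * \<eta> k)"
    unfolding dot_def sum_distrib_right by (rule sum.swap)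
  also have "\<dots> = (\<Sum>i\<in>S. (\<Sum>j\<in>choices J. q i j * ?u i j) - ?u i (y i))"
  proof (rule sum.cong[OF refl])
    fix i
    have "(\<Sum>k\<in>?K. (\<Sum>j\<in>choices J. q i j * attr x p i j k) * \<eta> k)
        = (\<Sum>j\<in>choices J. \<Sum>k\<in>?K. q i j * attr x p i j k * \<eta> k)"
      unfolding sum_distrib_right by (rule sum.swap)
    then show "(\<Sum>k\<in>?K. ((\<Sum>j\<in>choices J. q i j * attr x p i j k) - attr x p i (y i) k) * \<eta> k)
        = (\<Sum>j\<in>choices J. q i j * ?u i j) - ?u i (y i)"
      by (simp add: left_diff_distrib sum_subtractf dot_def sum_distrib_left mult.assoc)
  qed
  finally have residual:
    "dot ?K (\<lambda>k. \<Sum>i\<in>S. (\<Sum>j\<in>choices J. q i j * attr x p i j k) - attr x p i (y i) k) \<eta>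
      = (\<Sum>i\<in>S. (\<Sum>j\<in>choices J. q i j * ?u i j) - ?u i (y i))" .
  have "(\<Sum>i\<in>S. (\<Sum>j\<in>choices J. q i j * ?u i j) - (\<Sum>j\<in>choices J. q i j * ln (q i j)) - ?u i (y i))
      \<le> mnl_loss J F x p y S \<eta>"
    unfolding mnl_loss_def
  proof (rule sum_mono)
    fix i assume "i \<in> S"
    then have "(\<Sum>j\<in>choices J. q i j * ?u i j) - (\<Sum>j\<in>choices J. q i j * ln (q i j))
        \<le> ln (\<Sum>j\<in>choices J. exp (?u i j))"
      by (intro entropy_plus_mean_le_ln_sum_exp finite_choices fin nonneg mass)
    then show "(\<Sum>j\<in>choices J. q i j * ?u i j) - (\<Sum>j\<in>choices J. q i j * ln (q i j)) - ?u i (y i)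
        \<le> - ln (mnl_prob J F x p \<eta> i (y i))"
      by (simp add: ln_mnl_prob[OF fin])
  qed
  then show ?thesis
    unfolding residual by (simp add: entropy_sum_def sum_subtractf)
qed

lemma dot_combination_le_on_polyhedron:
  assumes "\<eta> \<in> polyhedron_of K R A b" and "\<And>r. r \<in> R \<Longrightarrow> 0 \<le> \<mu> r"
  shows "dot K (\<lambda>k. \<Sum>r\<in>R. A r k * \<mu> r) \<eta> \<le> dot R b \<mu>"
proof -
  have "dot K (\<lambda>k. \<Sum>r\<in>R. A r k * \<mu> r) \<eta> = (\<Sum>r\<in>R. \<Sum>k\<in>K. A r k * \<mu> r * \<eta> k)"
    unfolding dot_def sum_distrib_right by (rule sum.swap)
  also have "\<dots> = (\<Sum>r\<in>R. dot K (A r) \<eta> * \<mu> r)"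
    by (simp add: dot_def sum_distrib_left mult_ac)
  also have "\<dots> \<le> dot R b \<mu>"
    unfolding dot_def[of R] using assms
    by (intro sum_mono mult_right_mono) (auto simp: polyhedron_of_def)
  finally show ?thesis .
qed

lemma newton_LB_le_leaf_objective:
  assumes fin: "finite J" "finite F"
    and kkt: "newton_kkt (params J F) R A b (mnl_loss J F x p y S) \<theta> d \<mu>"
    and nonneg: "\<And>i j. i \<in> S \<Longrightarrow> j \<in> choices J \<Longrightarrow> 0 \<le> newton_q J F x p \<theta> d i j"
    and feasible: "\<eta> \<in> polyhedron_of (params J F) R A b"
  shows "newton_LB J F x p R b lam S \<theta> d \<mu> \<le> leaf_objective J F x p y lam S \<eta>"
proof -
  let ?q = "newton_q J F x p \<theta> d"
  let ?r = "\<lambda>k. \<Sum>i\<in>S. (\<Sum>j\<in>choices J. ?q i j * attr x p i j k) - attr x p i (y i) k"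
  have "?r k = - (\<Sum>r\<in>R. A r k * \<mu> r)" if "k \<in> params J F" for k
    using kkt that newton_residual[OF fin that, of x p y S \<theta> d]
    by (auto simp: newton_kkt_def)
  then have "dot (params J F) ?r \<eta> = - dot (params J F) (\<lambda>k. \<Sum>r\<in>R. A r k * \<mu> r) \<eta>"
    by (simp add: dot_def sum_negf)
  also have "\<dots> \<ge> - dot R b \<mu>"
    using dot_combination_le_on_polyhedron[OF feasible] kkt by (simp add: newton_kkt_def)
  finally have "- dot R b \<mu> \<le> dot (params J F) ?r \<eta>" .
  moreover have "entropy_sum J S ?q + dot (params J F) ?r \<eta> \<le> mnl_loss J F x p y S \<eta>"
    using fin nonneg by (intro mnl_loss_ge_entropy_plus_residual sum_newton_q)
  ultimately show ?thesis
    by (simp add: newton_LB_def leaf_objective_def)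
qed

theorem proposition1:
  fixes J :: "'j set" and F :: "'f set" and I S :: "'i set" and R :: "'r set"
    and x :: "'i \<Rightarrow> 'f \<Rightarrow> real" and p :: "'i \<Rightarrow> 'j \<Rightarrow> real" and y :: "'i \<Rightarrow> 'j option"
    and A :: "'r \<Rightarrow> ('j, 'f) param \<Rightarrow> real" and b :: "'r \<Rightarrow> real"
    and \<Theta> :: "(('j, 'f) param \<Rightarrow> real) set"
    and gam_low lam :: real and Nmin :: nat
    and \<theta> d :: "('j, 'f) param \<Rightarrow> real" and \<mu> :: "'r \<Rightarrow> real"
  assumes "finite J" and "J \<noteq> {}" and "finite F" and "finite I" and "finite R"
    and "\<And>i j. i \<in> I \<Longrightarrow> j \<in> J \<Longrightarrow> 0 \<le> p i j"
    and "\<And>i. i \<in> I \<Longrightarrow> y i \<in> choices J"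
    and "\<Theta> = polyhedron_of (params J F) R A b" and "\<Theta> \<noteq> {}"
    and "0 < gam_low" and "\<And>\<eta> j. \<eta> \<in> \<Theta> \<Longrightarrow> j \<in> J \<Longrightarrow> gam_low \<le> \<eta> (Gamma_at j)"
    and "0 \<le> lam" and "1 \<le> Nmin"
    and "\<And>T. T \<subseteq> I \<Longrightarrow> Nmin \<le> card T \<Longrightarrow> attains_min (leaf_objective J F x p y lam T) \<Theta>"
    and "S \<subseteq> I" and "\<theta> \<in> \<Theta>"
    and "newton_kkt (params J F) R A b (mnl_loss J F x p y S) \<theta> d \<mu>"
    and "\<And>i j. i \<in> S \<Longrightarrow> j \<in> choices J \<Longrightarrow> 0 \<le> newton_q J F x p \<theta> d i j"
  shows "ereal (newton_LB J F x p R b lam S \<theta> d \<mu>) \<le> leaf_cost J F x p y \<Theta> lam Nmin S"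
proof (cases "Nmin \<le> card S")
  case True
  with assms(14)[OF \<open>S \<subseteq> I\<close>] obtain z where z: "z \<in> \<Theta>"
      and "\<forall>w\<in>\<Theta>. leaf_objective J F x p y lam S z \<le> leaf_objective J F x p y lam S w"
    by (auto simp: attains_min_def)
  then have "(LEAST v. v \<in> leaf_objective J F x p y lam S ` \<Theta>) = leaf_objective J F x p y lam S z"
    by (intro Least_equality) auto
  moreover have "newton_LB J F x p R b lam S \<theta> d \<mu> \<le> leaf_objective J F x p y lam S z"
    using newton_LB_le_leaf_objective[OF assms(1,3,17,18)] z assms(8) by blast
  ultimately show ?thesis using True by (simp add: leaf_cost_def)
next
  case False
  then show ?thesis by (simp add: leaf_cost_def)
qed

end
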